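(* Consider the single-frequency RoPE phase flow on the circle ($d=2$) with $n=2r+1$ tokens, $r\ge1$, at positions $p_j=j$, $j=0,\ldots,n-1$, finite $\beta\ge0$, and frequency $\omega\in(2\mathbb{Z}+1)\pi$. The alternating twisted circle $\{(\theta_j)_{j=0}^{n-1}:\theta_j=c-\omega j \ (\mathrm{mod}\ 2\pi),\ c\in\mathbb{R}\}$ is a circle of equilibria, and the Jacobian $J$ of the phase vector field at each of its points has spectrum $$\operatorname{spec}(J)=\left\{-\tfrac1n\ (\text{mult. }r),\;0\ (\text{mult. }1),\;\tfrac1n\ (\text{mult. }r-1),\;1\ (\text{mult. }1)\right\}.$$ The unique zero mode is global phase rotation (the direction $(1,\dots,1)$). After quotienting by this symmetry, the equilibrium is a hyperbolic saddle with $r$ stable and $r$ unstable dimensions.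
   Context: Phase flow: for phases $\theta=(\theta_0,\dots,\theta_{n-1})$, let $W_{ij}=\exp\bigl(\beta\cos(\theta_i-\theta_j+\omega(p_i-p_j))\bigr)$, $A_{ij}=W_{ij}/\sum_kW_{ik}$, and $\dot\theta_i=\sum_jA_{ij}(\theta)\sin(\theta_j-\theta_i)$. The flow is equivariant under global phase shifts $\theta\mapsto\theta+c(1,\dots,1)$; quotienting by this symmetry means considering the linearization induced on $\mathbb{R}^n/\operatorname{span}\{(1,\dots,1)\}$. *)

theory Defs
  imports
    "HOL-Analysis.Analysis"
    "HOL-Library.Real_Mod"
    "HOL-Computational_Algebra.Fundamental_Theorem_Algebra"
    "Jordan_Normal_Form.Char_Poly"
begin

text \<open>From here on \<open>$\<close> and \<open>\<bullet>\<close> have their Analysis meaning.\<close>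

no_notation vec_index (infixl \<open>$\<close> 100)
no_notation scalar_prod (infix \<open>\<bullet>\<close> 70)


section \<open>The phase flow\<close>

text \<open>Tokens are indexed by a finite type; \<open>p i\<close> is the position of token \<open>i\<close>.\<close>

definition rope_weight :: "real \<Rightarrow> real \<Rightarrow> ('n \<Rightarrow> real) \<Rightarrow> real ^ 'n \<Rightarrow> 'n::finite \<Rightarrow> 'n \<Rightarrow> real" where
  "rope_weight \<beta> \<omega> p \<theta> i j = exp (\<beta> * cos (\<theta> $ i - \<theta> $ j + \<omega> * (p i - p j)))"

definition rope_attention :: "real \<Rightarrow> real \<Rightarrow> ('n \<Rightarrow> real) \<Rightarrow> real ^ 'n \<Rightarrow> 'n::finite \<Rightarrow> 'n \<Rightarrow> real" where
  "rope_attention \<beta> \<omega> p \<theta> i j =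
     rope_weight \<beta> \<omega> p \<theta> i j / (\<Sum>k\<in>UNIV. rope_weight \<beta> \<omega> p \<theta> i k)"

definition phase_field :: "real \<Rightarrow> real \<Rightarrow> ('n \<Rightarrow> real) \<Rightarrow> real ^ 'n \<Rightarrow> real ^ 'n::finite" where
  "phase_field \<beta> \<omega> p \<theta> =
     (\<chi> i. \<Sum>j\<in>UNIV. rope_attention \<beta> \<omega> p \<theta> i j * sin (\<theta> $ j - \<theta> $ i))"

definition twisted_circle :: "real \<Rightarrow> ('n \<Rightarrow> real) \<Rightarrow> (real ^ 'n::finite) set" where
  "twisted_circle \<omega> p = {\<theta>. \<exists>c. \<forall>j. [\<theta> $ j = c - \<omega> * p j] (rmod (2 * pi))}"

text \<open>Phases are real lifts; this is the covering map onto the torus of unit complex numbers.\<close>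

definition to_torus :: "real ^ 'n \<Rightarrow> complex ^ 'n::finite" where
  "to_torus \<theta> = (\<chi> j. cis (\<theta> $ j))"


section \<open>Spectrum of an endomorphism of a finite-dimensional real vector space\<close>

definition is_basis :: "'a::real_vector list \<Rightarrow> bool" where
  "is_basis bs \<longleftrightarrow> distinct bs \<and> independent (set bs) \<and> span (set bs) = UNIV"

definition basis_mat :: "'a::real_vector list \<Rightarrow> 'a list \<Rightarrow> ('a \<Rightarrow> 'a) \<Rightarrow> real mat" where
  "basis_mat cs bs L = Matrix.mat (length cs) (length bs)
     (\<lambda>(i, j). representation (set cs) (L (bs ! j)) (cs ! i))"

text \<open>The characteristic polynomial does not depend on the chosen basis, see
  \<open>endo_char_poly_eq\<close> below.\<close>

definition endo_char_poly :: "('a::real_vector \<Rightarrow> 'a) \<Rightarrow> real poly" where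
  "endo_char_poly L = (let bs = SOME bs. is_basis bs in char_poly (basis_mat bs bs L))"

text \<open>All complex eigenvalues, counted with algebraic multiplicity.\<close>

definition endo_spec :: "('a::real_vector \<Rightarrow> 'a) \<Rightarrow> complex multiset" where
  "endo_spec L = proots (map_poly complex_of_real (endo_char_poly L))"

definition stable_dim :: "('a::real_vector \<Rightarrow> 'a) \<Rightarrow> nat" where
  "stable_dim L = size (filter_mset (\<lambda>z. Re z < 0) (endo_spec L))"

definition unstable_dim :: "('a::real_vector \<Rightarrow> 'a) \<Rightarrow> nat" where
  "unstable_dim L = size (filter_mset (\<lambda>z. Re z > 0) (endo_spec L))"

definition hyperbolic :: "('a::real_vector \<Rightarrow> 'a) \<Rightarrow> bool" where
  "hyperbolic L \<longleftrightarrow> (\<forall>z \<in># endo_spec L. Re z \<noteq> 0)"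

definition hyperbolic_saddle :: "('a::real_vector \<Rightarrow> 'a) \<Rightarrow> bool" where
  "hyperbolic_saddle L \<longleftrightarrow> hyperbolic L \<and> stable_dim L > 0 \<and> unstable_dim L > 0"

lemma is_basis_sum_nth:
  assumes "is_basis bs"
  shows "(\<Sum>k<length bs. representation (set bs) v (bs ! k) *\<^sub>R bs ! k) = v"
proof -
  have "(\<Sum>k<length bs. representation (set bs) v (bs ! k) *\<^sub>R bs ! k)
      = (\<Sum>b\<in>set bs. representation (set bs) v b *\<^sub>R b)"
    using assms unfolding is_basis_def
    by (intro sum.reindex_bij_betw bij_betw_nth) auto
  also have "\<dots> = v"
    using assms unfolding is_basis_def
    by (intro real_vector.sum_representation_eq) auto
  finally show ?thesis .
qed

lemma is_basis_length:
  assumes "is_basis (bs :: 'a list)" "is_basis (cs :: 'a::real_vector list)"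
  shows "length bs = length cs"
proof -
  have "length ds = dim (UNIV :: 'a set)" if "is_basis ds" for ds :: "'a list"
  proof -
    have ds: "distinct ds" "independent (set ds)" "span (set ds) = UNIV"
      using that by (auto simp: is_basis_def)
    have "dim (UNIV :: 'a set) = dim (set ds)"
      unfolding ds(3)[symmetric] by (rule real_vector.dim_span)
    also have "\<dots> = card (set ds)"
      using ds(2) by (rule real_vector.dim_eq_card_independent)
    also have "\<dots> = length ds"
      using ds(1) by (rule distinct_card)
    finally show ?thesis ..
  qed
  then show ?thesis using assms by simp
qed

lemma representation_linear_image:
  assumes bs: "is_basis bs" and cs: "is_basis cs" and L: "linear L"
  shows "representation (set cs) (L v) c
       = (\<Sum>k<length bs. representation (set cs) (L (bs ! k)) c * representation (set bs) v (bs ! k))"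
proof -
  have c: "independent (set cs)" "\<And>x. x \<in> span (set cs)"
    using cs by (auto simp: is_basis_def)
  have "L v = (\<Sum>k<length bs. representation (set bs) v (bs ! k) *\<^sub>R L (bs ! k))"
    by (subst is_basis_sum_nth[OF bs, of v, symmetric])
       (simp add: linear_sum[OF L] linear_scale[OF L])
  then show ?thesis
    by (simp add: real_vector.representation_sum[OF c] real_vector.representation_scale[OF c] mult.commute)
qed

lemma basis_mat_mult:
  assumes "is_basis bs" "is_basis cs" "linear L"
  shows "basis_mat cs bs L * basis_mat bs ds K = basis_mat cs ds (L \<circ> K)"
proof (rule eq_matI)
  fix i j assume "i < dim_row (basis_mat cs ds (L \<circ> K))" "j < dim_col (basis_mat cs ds (L \<circ> K))"
  then show "(basis_mat cs bs L * basis_mat bs ds K) $$ (i, j) = basis_mat cs ds (L \<circ> K) $$ (i, j)"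
    using representation_linear_image[OF assms, of "K (ds ! j)" "cs ! i", symmetric]
    by (simp add: basis_mat_def scalar_prod_def atLeast0LessThan)
qed (simp_all add: basis_mat_def)

lemma basis_mat_id:
  assumes "is_basis bs"
  shows "basis_mat bs bs id = 1\<^sub>m (length bs)"
  using assms
  by (intro eq_matI)
     (auto simp: basis_mat_def is_basis_def real_vector.representation_basis nth_eq_iff_index_eq)

lemma endo_char_poly_eq:
  assumes bs: "is_basis (bs :: 'a::real_vector list)" and L: "linear L"
  shows "endo_char_poly L = char_poly (basis_mat bs bs L)"
proof -
  define cs where "cs = (SOME cs :: 'a list. is_basis cs)"
  have cs: "is_basis cs"
    unfolding cs_def by (rule someI[of is_basis, OF bs])
  let ?P = "basis_mat cs bs id" and ?Q = "basis_mat bs cs id"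
  have len: "length bs = length cs" by (rule is_basis_length[OF bs cs])
  have 1: "?P * ?Q = 1\<^sub>m (length cs)"
    by (simp add: basis_mat_mult[OF bs cs linear_id] basis_mat_id[OF cs])
  have 2: "?Q * ?P = 1\<^sub>m (length cs)"
    by (simp add: basis_mat_mult[OF cs bs linear_id] basis_mat_id[OF bs] len)
  have 3: "basis_mat cs cs L = ?P * basis_mat bs bs L * ?Q"
    by (simp add: basis_mat_mult[OF bs cs linear_id] basis_mat_mult[OF bs cs L])
  have "similar_mat_wit (basis_mat cs cs L) (basis_mat bs bs L) ?P ?Q"
    by (rule similar_mat_witI[OF 1 2 3]) (simp_all add: basis_mat_def len)
  then have "char_poly (basis_mat cs cs L) = char_poly (basis_mat bs bs L)"
    by (intro char_poly_similar) (auto simp: similar_mat_def)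
  then show ?thesis
    by (simp add: endo_char_poly_def Let_def cs_def)
qed


section \<open>The quotient by global phase shifts\<close>

text \<open>\<open>1 :: real ^ 'n\<close> is the all-ones vector.\<close>

quotient_type (overloaded) ('n) phase_quotient = "real ^ 'n::finite"
  / "\<lambda>x y. x - y \<in> span {1 :: real ^ 'n}"
  morphisms quot_rep quot_proj
proof (rule equivpI)
  show "reflp (\<lambda>x y. x - y \<in> span {1 :: real ^ 'n})"
    by (auto intro!: reflpI simp: span_zero)
  show "symp (\<lambda>x y. x - y \<in> span {1 :: real ^ 'n})"
    by (rule sympI) (metis minus_diff_eq span_neg)
  show "transp (\<lambda>x y. x - y \<in> span {1 :: real ^ 'n})"
  proof (rule transpI)
    fix x y z :: "real ^ 'n"
    assume "x - y \<in> span {1}" "y - z \<in> span {1}"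
    then have "(x - y) + (y - z) \<in> span {1}" by (rule span_add)
    then show "x - z \<in> span {1}" by simp
  qed
qed

instantiation phase_quotient :: (finite) real_vector
begin

lift_definition zero_phase_quotient :: "'a phase_quotient" is "0" .

lift_definition plus_phase_quotient :: "'a phase_quotient \<Rightarrow> 'a phase_quotient \<Rightarrow> 'a phase_quotient"
  is "(+)"
  by (metis add_diff_add span_add)

lift_definition minus_phase_quotient :: "'a phase_quotient \<Rightarrow> 'a phase_quotient \<Rightarrow> 'a phase_quotient"
  is "(-)"
proof -
  fix x y z w :: "real ^ 'a"
  assume "x - y \<in> span {1}" "z - w \<in> span {1}"
  then have "(x - y) - (z - w) \<in> span {1}" by (rule span_diff)
  then show "(x - z) - (y - w) \<in> span {1}" by (simp add: algebra_simps)
qed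

lift_definition uminus_phase_quotient :: "'a phase_quotient \<Rightarrow> 'a phase_quotient"
  is "uminus"
  by (metis minus_diff_minus span_neg)

lift_definition scaleR_phase_quotient :: "real \<Rightarrow> 'a phase_quotient \<Rightarrow> 'a phase_quotient"
  is "scaleR"
  by (metis scaleR_diff_right span_scale)

instance
  by standard (transfer; simp add: span_zero algebra_simps)+

end

lemma linear_quot_proj: "linear quot_proj"
  by (rule linearI)
     (simp_all add: plus_phase_quotient.abs_eq scaleR_phase_quotient.abs_eq)

end

theory Submission
  imports Defs
begin

text \<open>On the twisted circle the rotated phases \<open>\<theta>\<^sub>j + \<omega> p\<^sub>j\<close> all agree modulo \<open>2 \<pi>\<close>, so every attention score is at its
  maximum, the attention is uniform, and the phases themselves differ by multiples of \<open>\<pi>\<close>: every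
  sine in the vector field vanishes. For the same reason the derivative of the attention weights,
  multiplied by such a sine, does not enter the linearization
  (\<open>phase_field_has_derivative_locked\<close>). What survives is
  \<open>J = (s s\<^sup>T - diag s) / n\<close> with \<open>s\<^sub>i = (-1)\<^sup>i\<close>; the diagonal has this form because
  the sum of the signs is \<open>1\<close> for odd \<open>n\<close> (\<open>phase_field_twisted_circle\<close>).

  This operator has an explicit eigenbasis (\<open>sign_eigenbasis\<close>). A vector supported on one sign
  class with coordinate sum zero is orthogonal to \<open>s\<close>, so only the diagonal part acts: the
  \<open>r + 1\<close> even tokens give \<open>r\<close> modes of eigenvalue \<open>-1/n\<close>, the \<open>r\<close> odd tokens give
  \<open>r - 1\<close> modes of eigenvalue \<open>1/n\<close>. On the remaining plane, spanned by the all-ones vector \<open>1\<close>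
  and \<open>s\<close>, one has \<open>J 1 = 0\<close> and \<open>J s = s - 1/n\<close>, whence \<open>s - 1/n\<close> has eigenvalue \<open>1\<close>.
  Since \<open>1\<close> is a member of this eigenbasis, the classes of the other members form an eigenbasis
  of the quotient (\<open>is_basis_quot_proj\<close>), and passing to the quotient removes exactly the
  eigenvalue \<open>0\<close> from the spectrum.\<close>

section \<open>Operators with an eigenbasis\<close>

lemma proots_real_linear_factors:
  "proots (map_poly complex_of_real (\<Prod>a\<leftarrow>ds. [:- a, 1:])) = mset (map complex_of_real ds)"
proof (induction ds)
  case (Cons a ds)
  have "(\<Prod>a\<leftarrow>ds. [:- a, 1:]) \<noteq> 0"
    by (auto simp: prod_list_zero_iff)
  then have nz: "map_poly complex_of_real (\<Prod>a\<leftarrow>ds. [:- a, 1:]) \<noteq> 0"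
    by (simp add: map_poly_eq_0_iff)
  have "map_poly complex_of_real (\<Prod>a\<leftarrow>a # ds. [:- a, 1:])
      = [:- complex_of_real a, 1:] * map_poly complex_of_real (\<Prod>a\<leftarrow>ds. [:- a, 1:])"
    by (simp add: poly_eq_iff coeff_map_poly coeff_pCons split: nat.split)
  moreover have "proots [:- complex_of_real a, 1:] = {#complex_of_real a#}"
    using proots_linear_factor[of "complex_of_real a"] by simp
  ultimately show ?case
    using Cons nz by (simp add: proots_mult del: mult_pCons_left)
qed simp

text \<open>In an eigenbasis the matrix is diagonal. The eigenvalues are given by a second list matched
  with the basis entry by entry, so that their repetitions record the algebraic multiplicities.\<close>

lemma endo_spec_eigenbasis:
  assumes bs: "is_basis bs" and L: "linear L"
    and eig: "list_all2 (\<lambda>b d. L b = d *\<^sub>R b) bs ds"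
  shows "endo_spec L = mset (map complex_of_real ds)"
proof -
  let ?M = "basis_mat bs bs L"
  have len: "length ds = length bs"
    using eig by (simp add: list_all2_lengthD)
  have ind: "independent (set bs)" "distinct bs" "\<And>v. v \<in> span (set bs)"
    using bs by (auto simp: is_basis_def)
  have entry: "?M $$ (i, j) = (if i = j then ds ! j else 0)"
    if "i < length bs" "j < length bs" for i j
  proof -
    have "L (bs ! j) = ds ! j *\<^sub>R bs ! j"
      using eig that by (simp add: list_all2_conv_all_nth)
    then show ?thesis
      using that ind
      by (simp add: basis_mat_def real_vector.representation_scale
          real_vector.representation_basis nth_eq_iff_index_eq)
  qed
  have carrier: "?M \<in> carrier_mat (length bs) (length bs)"
    by (simp add: basis_mat_def)
  have upper: "upper_triangular ?M"
    using entry carrier by (auto simp: upper_triangular_def)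
  have "diag_mat ?M = ds"
    using entry carrier len by (intro nth_equalityI) (auto simp: diag_mat_def)
  then have "endo_char_poly L = (\<Prod>a\<leftarrow>ds. [:- a, 1:])"
    using char_poly_upper_triangular[OF carrier upper] endo_char_poly_eq[OF bs L] by simp
  then show ?thesis
    by (simp add: endo_spec_def proots_real_linear_factors)
qed

lemma stable_unstable_dim_real_spec:
  assumes "endo_spec L = mset (map complex_of_real ds)"
  shows "stable_dim L = length (filter (\<lambda>d. d < 0) ds)"
    and "unstable_dim L = length (filter (\<lambda>d. d > 0) ds)"
  unfolding stable_dim_def unstable_dim_def assms
  by (simp_all only: mset_filter[symmetric] size_mset filter_map length_map o_def Re_complex_of_real)

section \<open>Operators induced on the quotient\<close>

lemma quot_proj_eq_iff: "quot_proj x = quot_proj y \<longleftrightarrow> x - y \<in> span {1}"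
  by (rule phase_quotient.abs_eq_iff)

lemma quot_proj_rep [simp]: "quot_proj (quot_rep q) = q"
  by (rule Quotient3_abs_rep[OF Quotient3_phase_quotient])

lemma quot_proj_one: "quot_proj 1 = 0"
  by (simp add: zero_phase_quotient.abs_eq quot_proj_eq_iff span_base)

text \<open>The vectors \<open>es\<close> span a complement of the line of global shifts, and the projection is
  injective on any complement of its kernel.\<close>

lemma is_basis_quot_proj:
  fixes es :: "(real ^ 'n::finite) list"
  assumes "is_basis (1 # es)"
  shows "is_basis (map quot_proj es)"
proof -
  have dist: "distinct es" "1 \<notin> set es"
    and ind: "independent (insert 1 (set es))"
    and span: "span (insert 1 (set es)) = UNIV"
    using assms by (auto simp: is_basis_def)
  have ind_es: "independent (set es)" and one: "1 \<notin> span (set es)"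
    using ind dist by (auto simp: real_vector.independent_insert)
  have inj: "inj_on quot_proj (span (set es))"
  proof (rule inj_onI)
    fix x y assume xy: "x \<in> span (set es)" "y \<in> span (set es)" "quot_proj x = quot_proj y"
    then obtain c where c: "x - y = c *\<^sub>R 1"
      by (auto simp: quot_proj_eq_iff span_singleton)
    have mem: "c *\<^sub>R 1 \<in> span (set es)"
      using xy span_diff[of x "set es" y] c by simp
    have "c = 0"
    proof (rule ccontr)
      assume "c \<noteq> 0"
      then have "1 = inverse c *\<^sub>R (c *\<^sub>R (1 :: real ^ 'n))"
        by simp
      then show False
        using span_scale[OF mem, of "inverse c"] one by simp
    qed
    then show "x = y" using c by simp
  qed
  have "independent (quot_proj ` set es)"
    by (rule linear_independent_injective_image[OF linear_quot_proj ind_es inj])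
  moreover have "distinct (map quot_proj es)"
    using dist inj_on_subset[OF inj span_superset] by (simp add: distinct_map)
  moreover have "span (quot_proj ` set es) = UNIV"
  proof -
    have "span (quot_proj ` set es) = span (quot_proj ` insert 1 (set es))"
      by (simp add: quot_proj_one)
    also have "\<dots> = range quot_proj"
      by (simp only: linear_span_image[OF linear_quot_proj] span)
    also have "\<dots> = UNIV"
      by (metis quot_proj_rep surjI)
    finally show ?thesis .
  qed
  ultimately show ?thesis
    by (simp add: is_basis_def)
qed

text \<open>An operator that kills the shift direction is constant on cosets, so it descends; the induced
  map is unique because the projection is surjective.\<close>

lemma ex1_induced_quotient_map:
  fixes L :: "real ^ 'n::finite \<Rightarrow> real ^ 'n"
  assumes L: "linear L" and one: "L 1 = 0"
  shows "\<exists>!K. linear K \<and> (\<forall>v. K (quot_proj v) = quot_proj (L v))"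
proof -
  define K where "K q = quot_proj (L (quot_rep q))" for q
  have K: "K (quot_proj v) = quot_proj (L v)" for v
  proof -
    have "quot_rep (quot_proj v) - v \<in> span {1}"
      by (simp flip: quot_proj_eq_iff)
    then obtain c where "quot_rep (quot_proj v) - v = c *\<^sub>R 1"
      by (auto simp: span_singleton)
    then have "L (quot_rep (quot_proj v)) - L v = 0"
      by (simp add: one linear_scale[OF L] flip: linear_diff[OF L])
    then show ?thesis
      by (simp add: K_def)
  qed
  have "linear K"
  proof (rule linearI)
    fix p q :: "'n phase_quotient" and c :: real
    have "K (quot_proj x + quot_proj y) = K (quot_proj x) + K (quot_proj y)" for x y
      by (simp add: K linear_add[OF L] flip: linear_add[OF linear_quot_proj])
    then show "K (p + q) = K p + K q"
      by (metis quot_proj_rep)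
    have "K (c *\<^sub>R quot_proj x) = c *\<^sub>R K (quot_proj x)" for x
      by (simp add: K linear_scale[OF L] flip: linear_scale[OF linear_quot_proj])
    then show "K (c *\<^sub>R p) = c *\<^sub>R K p"
      by (metis quot_proj_rep)
  qed
  moreover have "K' = K" if "\<forall>v. K' (quot_proj v) = quot_proj (L v)" for K'
    using that K by (metis quot_proj_rep ext)
  ultimately show ?thesis
    using K by blast
qed

lemma endo_spec_induced_quotient_map:
  fixes L :: "real ^ 'n::finite \<Rightarrow> real ^ 'n"
  assumes "is_basis (1 # es)"
    and "list_all2 (\<lambda>b d. L b = d *\<^sub>R b) es ds"
    and "linear K" and "\<forall>v. K (quot_proj v) = quot_proj (L v)"
  shows "endo_spec K = mset (map complex_of_real ds)"
proof (rule endo_spec_eigenbasis[OF is_basis_quot_proj[OF assms(1)] assms(3)])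
  show "list_all2 (\<lambda>b d. K b = d *\<^sub>R b) (map quot_proj es) ds"
    using assms(2,4)
    by (simp add: list_all2_conv_all_nth linear_scale[OF linear_quot_proj])
qed

section \<open>Rank-one perturbation of a sign matrix\<close>

text \<open>The matrix of this operator is \<open>(s s\<^sup>T - diag s) / n\<close>.\<close>

definition sign_operator :: "real ^ 'n \<Rightarrow> real ^ 'n \<Rightarrow> real ^ 'n::finite" where
  "sign_operator s v = (\<chi> i. s $ i * (s \<bullet> v - v $ i) / real CARD('n))"

lemma linear_sign_operator: "linear (sign_operator s)"
  by (rule linearI)
     (simp_all add: sign_operator_def Finite_Cartesian_Product.vec_eq_iff inner_add_right field_simps)

lemma is_basis_of_spanning:
  fixes bs :: "'a::euclidean_space list"
  assumes span: "span (set bs) = UNIV" and len: "length bs = DIM('a)"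
  shows "is_basis bs"
proof -
  have "DIM('a) \<le> card (set bs)"
    using span dim_le_card[of "UNIV :: 'a set" "set bs"] by simp
  then have card: "card (set bs) = length bs"
    using len card_length[of bs] by simp
  then have "independent (set bs)"
    using span len by (intro card_le_dim_spanning[where V = UNIV]) auto
  then show ?thesis
    using span card by (simp add: is_basis_def card_distinct)
qed

text \<open>Averaging the differences recovers the base axis vector: \<open>card A\<close> times it is the indicator of
  \<open>A\<close> minus the sum of all the differences.\<close>

lemma axis_in_span:
  fixes A :: "'n::finite set"
  assumes ind: "(\<Sum>a\<in>A. axis a 1) \<in> span X"
    and diff: "\<And>a. a \<in> A \<Longrightarrow> axis a 1 - axis a0 1 \<in> span X"
    and a: "a \<in> A"
  shows "(axis a 1 :: real ^ 'n) \<in> span X"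
proof -
  have nz: "card A \<noteq> 0"
    using a by auto
  have "(\<Sum>a\<in>A. axis a 1) - (\<Sum>a\<in>A. axis a 1 - axis a0 1) = real (card A) *\<^sub>R (axis a0 1 :: real ^ 'n)"
    by (simp add: sum_subtractf sum_constant_scaleR del: sum_constant)
  moreover have "(\<Sum>a\<in>A. axis a 1) - (\<Sum>a\<in>A. axis a 1 - axis a0 1) \<in> span X"
    by (intro span_diff span_sum ind diff)
  ultimately have "inverse (real (card A)) *\<^sub>R real (card A) *\<^sub>R (axis a0 1 :: real ^ 'n) \<in> span X"
    by (metis span_scale)
  then have "axis a0 1 \<in> span X"
    using nz by simp
  then show ?thesis
    using span_add[OF diff[OF a], of "axis a0 1"] by simp
qed

text \<open>A sign vector of sum \<open>1\<close> has one more positive than negative entry, as the alternating signs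
  \<open>(-1)\<^sup>i\<close> do in odd dimension. The sum condition is what makes \<open>1\<close> a zero mode.\<close>

locale balanced_signs =
  fixes s :: "real ^ 'n::finite"
  assumes sign: "s $ i = 1 \<or> s $ i = -1"
    and sum_sign: "(\<Sum>i\<in>UNIV. s $ i) = 1"
begin

lemma sign_square: "s $ i * s $ i = 1"
  using sign[of i] by auto

lemma inner_sign_one: "s \<bullet> 1 = 1"
  using sum_sign by (simp add: inner_vec_def)

lemma inner_sign_self: "s \<bullet> s = real CARD('n)"
  by (simp add: inner_vec_def sign_square)

lemma sign_operator_one: "sign_operator s 1 = 0"
  by (simp add: sign_operator_def inner_sign_one Finite_Cartesian_Product.vec_eq_iff)

text \<open>Each sign is invertible, so \<open>v\<close> is in the kernel exactly when every coordinate of \<open>v\<close> equals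
  the one number \<open>s \<bullet> v\<close>.\<close>

lemma kernel_sign_operator: "{v. sign_operator s v = 0} = span {1}"
proof (intro Set.equalityI subsetI)
  fix v assume "v \<in> {v. sign_operator s v = 0}"
  then have "s $ i * (s \<bullet> v - v $ i) = 0" for i
    by (simp add: sign_operator_def Finite_Cartesian_Product.vec_eq_iff)
  moreover have "s $ i \<noteq> 0" for i
    using sign[of i] by auto
  ultimately have "v = (s \<bullet> v) *\<^sub>R 1"
    by (simp add: Finite_Cartesian_Product.vec_eq_iff)
  then show "v \<in> span {1}"
    by (metis span_base span_scale insertI1)
next
  fix v assume "v \<in> span {1 :: real ^ 'n}"
  then show "v \<in> {v. sign_operator s v = 0}"
    by (auto simp: span_singleton linear_scale[OF linear_sign_operator] sign_operator_one)
qed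

text \<open>Two indices with the same sign: the difference is orthogonal to \<open>s\<close>, which removes the
  rank-one part.\<close>

lemma sign_operator_diff:
  assumes "s $ a = \<sigma>" and "s $ b = \<sigma>"
  shows "sign_operator s (axis a 1 - axis b 1)
       = (- \<sigma> / real CARD('n)) *\<^sub>R (axis a 1 - axis b 1)"
proof -
  have "s \<bullet> (axis a 1 - axis b 1) = 0"
    using assms by (simp add: inner_diff_right inner_axis)
  then show ?thesis
    using assms by (auto simp: sign_operator_def Finite_Cartesian_Product.vec_eq_iff axis_def)
qed

text \<open>The correction by \<open>1/n\<close> moves \<open>s\<close> along the kernel onto its own image
  \<open>s - 1/n\<close>, which is therefore fixed.\<close>

lemma sign_operator_unstable:
  defines "w \<equiv> s - (1 / real CARD('n)) *\<^sub>R 1"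
  shows "sign_operator s w = w"
proof (subst Finite_Cartesian_Product.vec_eq_iff, intro allI)
  fix i
  have "sign_operator s w $ i = s $ i * (real CARD('n) - s $ i) / real CARD('n)"
    by (simp add: sign_operator_def w_def inner_diff_right inner_sign_self inner_sign_one)
  also have "\<dots> = w $ i"
    using sign_square[of i] by (simp add: w_def field_simps)
  finally show "sign_operator s w $ i = w $ i" .
qed

lemma card_signs:
  assumes "CARD('n) = 2 * r + 1"
  shows "card {i. s $ i = 1} = r + 1" and "card {i. s $ i = -1} = r"
proof -
  let ?A = "{i. s $ i = 1}" and ?B = "{i. s $ i = -1}"
  have U: "UNIV = ?A \<union> ?B"
    using sign by auto
  have disj: "?A \<inter> ?B = {}"
    by auto
  have "card ?A + card ?B = 2 * r + 1"
    using card_Un_disjoint[OF _ _ disj] U assms by simp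
  moreover have "real (card ?A) - real (card ?B) = 1"
  proof -
    have "(\<Sum>i\<in>UNIV. s $ i) = (\<Sum>i\<in>?A. s $ i) + (\<Sum>i\<in>?B. s $ i)"
      unfolding U by (rule sum.union_disjoint) (use disj in auto)
    then show ?thesis
      using sum_sign by simp
  qed
  ultimately show "card ?A = r + 1" "card ?B = r"
    by linarith+
qed

text \<open>The modes are differences of axis vectors within a sign class, based at \<open>a0\<close> and \<open>b0\<close>, and
  \<open>s - 1/n\<close>. Together with \<open>1\<close> there are \<open>2 r + 1\<close> of them, so it suffices that they span: the
  combinations \<open>(1 + s) / 2\<close> and \<open>(1 - s) / 2\<close> are the indicators of the two classes, from which
  the differences recover each axis vector.\<close>

lemma sign_eigenbasis:
  assumes card: "CARD('n) = 2 * r + 1" and r: "r \<ge> 1"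
  shows "\<exists>es. is_basis (1 # es) \<and>
    list_all2 (\<lambda>b d. sign_operator s b = d *\<^sub>R b) es
      (replicate r (- 1 / real CARD('n)) @ replicate (r - 1) (1 / real CARD('n)) @ [1])"
proof -
  let ?A = "{i. s $ i = 1}" and ?B = "{i. s $ i = -1}"
  let ?d = "\<lambda>b a. axis a 1 - axis b 1 :: real ^ 'n"
  let ?w = "s - (1 / real CARD('n)) *\<^sub>R 1"
  obtain a0 where a0: "s $ a0 = 1"
    using card_signs(1)[OF card] by (metis (mono_tags, lifting) Collect_empty_eq card.empty add_is_0 one_neq_zero)
  obtain b0 where b0: "s $ b0 = -1"
    using card_signs(2)[OF card] r by (metis (mono_tags, lifting) Collect_empty_eq card.empty not_one_le_zero)
  obtain as where as: "set as = ?A - {a0}" "distinct as"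
    using finite_distinct_list[of "?A - {a0}"] by auto
  obtain bs where bs: "set bs = ?B - {b0}" "distinct bs"
    using finite_distinct_list[of "?B - {b0}"] by auto
  have len: "length as = r" "length bs = r - 1"
    using distinct_card[OF as(2)] distinct_card[OF bs(2)] as bs a0 b0 card_signs[OF card]
    by simp_all
  define es where "es = map (?d a0) as @ map (?d b0) bs @ [?w]"
  have eig: "list_all2 (\<lambda>b d. sign_operator s b = d *\<^sub>R b) es
      (replicate r (- 1 / real CARD('n)) @ replicate (r - 1) (1 / real CARD('n)) @ [1])"
  proof -
    have "list_all2 (\<lambda>b d. sign_operator s b = d *\<^sub>R b) (map (?d a0) as) (replicate r (- 1 / real CARD('n)))"
    proof -
      have "s $ (as ! i) = 1" if "i < length as" for i
        using as nth_mem[OF that] by auto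
      then show ?thesis
        using len sign_operator_diff[OF _ a0] by (simp add: list_all2_conv_all_nth)
    qed
    moreover have "list_all2 (\<lambda>b d. sign_operator s b = d *\<^sub>R b) (map (?d b0) bs) (replicate (r - 1) (1 / real CARD('n)))"
    proof -
      have "s $ (bs ! i) = -1" if "i < length bs" for i
        using bs nth_mem[OF that] by auto
      then show ?thesis
        using len sign_operator_diff[OF _ b0] by (simp add: list_all2_conv_all_nth)
    qed
    ultimately show ?thesis
      unfolding es_def
      by (intro list_all2_appendI) (simp_all add: sign_operator_unstable)
  qed
  let ?X = "set (1 # es)"
  have one: "1 \<in> span ?X" and w: "?w \<in> span ?X"
    by (auto simp: es_def intro: span_base)
  have "?w + (1 / real CARD('n)) *\<^sub>R 1 \<in> span ?X"
    by (intro span_add w span_scale one)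
  then have s: "s \<in> span ?X"
    by simp
  have "(\<Sum>a\<in>?A. axis a 1) = (1/2) *\<^sub>R (1 + s)"
  proof (subst Finite_Cartesian_Product.vec_eq_iff, intro allI)
    show "(\<Sum>a\<in>?A. axis a 1) $ i = ((1/2) *\<^sub>R (1 + s)) $ i" for i
      using sign[of i] by (auto simp: sum_component axis_def)
  qed
  then have A: "(\<Sum>a\<in>?A. axis a 1) \<in> span ?X"
    using one s by (simp only: span_scale span_add)
  have "(\<Sum>b\<in>?B. axis b 1) = (1/2) *\<^sub>R (1 - s)"
  proof (subst Finite_Cartesian_Product.vec_eq_iff, intro allI)
    show "(\<Sum>b\<in>?B. axis b 1) $ i = ((1/2) *\<^sub>R (1 - s)) $ i" for i
      using sign[of i] by (auto simp: sum_component axis_def)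
  qed
  then have B: "(\<Sum>b\<in>?B. axis b 1) \<in> span ?X"
    using one s by (simp only: span_scale span_diff)
  have dA: "?d a0 a \<in> span ?X" if "a \<in> ?A" for a
    using that as by (cases "a = a0") (auto simp: span_zero es_def intro!: span_base)
  have dB: "?d b0 b \<in> span ?X" if "b \<in> ?B" for b
    using that bs by (cases "b = b0") (auto simp: span_zero es_def intro!: span_base)
  have "axis i 1 \<in> span ?X" for i
    using axis_in_span[OF A dA] axis_in_span[OF B dB] sign[of i] by blast
  then have "Basis \<subseteq> span ?X"
    by (auto simp: Basis_vec_def)
  then have "span ?X = UNIV"
    by (metis span_Basis span_minimal subspace_span top.extremum_uniqueI)
  moreover have "length (1 # es) = DIM(real ^ 'n)"
    using len card r by (simp add: es_def)
  ultimately have "is_basis (1 # es)"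
    by (rule is_basis_of_spanning)
  with eig show ?thesis by blast
qed

end

section \<open>The twisted circle and its linearization\<close>

text \<open>On the torus the set is the orbit \<open>z \<mapsto> (z cis (- \<omega> p\<^sub>j))\<^sub>j\<close> of a free
  action of the unit circle, and a continuous injection of a compact space is a homeomorphism
  onto its image.\<close>

lemma homeomorphic_to_torus_twisted_circle:
  fixes p :: "'n::finite \<Rightarrow> real"
  shows "to_torus ` twisted_circle \<omega> p homeomorphic sphere (0::complex) 1"
proof -
  define g :: "complex \<Rightarrow> complex ^ 'n" where "g z = (\<chi> j. z * cis (- \<omega> * p j))" for z
  have "to_torus ` twisted_circle \<omega> p = g ` sphere 0 1"
  proof (intro Set.equalityI subsetI)
    fix x assume "x \<in> to_torus ` twisted_circle \<omega> p"
    then obtain \<theta> c where x: "x = to_torus \<theta>" and c: "\<forall>j. [\<theta> $ j = c - \<omega> * p j] (rmod (2 * pi))"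
      by (auto simp: twisted_circle_def)
    have "cis (\<theta> $ j) = cis c * cis (- \<omega> * p j)" for j
    proof -
      obtain k :: int where "c - \<omega> * p j = \<theta> $ j + of_int k * (2 * pi)"
        using c by (auto simp: rcong_altdef)
      then have "cis (c - \<omega> * p j) = cis (\<theta> $ j) * cis (2 * pi * of_int k)"
        by (simp add: cis_mult mult.commute)
      then show ?thesis
        by (simp add: cis_mult cis_multiple_2pi)
    qed
    then have "x = g (cis c)"
      by (simp add: x g_def to_torus_def Finite_Cartesian_Product.vec_eq_iff)
    then show "x \<in> g ` sphere 0 1"
      by auto
  next
    fix x assume "x \<in> g ` sphere 0 1"
    then obtain z where x: "x = g z" and z: "norm z = 1"
      by auto
    then obtain c where c: "z = cis c"
      by (metis complex_norm_eq_1_exp cis_conv_exp mult.commute)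
    have "x = to_torus (\<chi> j. c - \<omega> * p j)"
      by (simp add: x c g_def to_torus_def Finite_Cartesian_Product.vec_eq_iff cis_mult)
    moreover have "(\<chi> j. c - \<omega> * p j) \<in> twisted_circle \<omega> p"
      by (auto simp: twisted_circle_def)
    ultimately show "x \<in> to_torus ` twisted_circle \<omega> p"
      by blast
  qed
  moreover have "sphere (0::complex) 1 homeomorphic g ` sphere 0 1"
  proof (rule homeomorphic_compact)
    show "continuous_on (sphere 0 1) g"
      unfolding g_def by (intro continuous_intros)
    show "inj_on g (sphere 0 1)"
      by (auto simp: inj_on_def g_def Finite_Cartesian_Product.vec_eq_iff)
  qed auto
  ultimately show ?thesis
    by (metis homeomorphic_sym)
qed

text \<open>By the product rule the derivative of the attention always comes multiplied by a sine of a phase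
  difference, hence it drops out and only differentiability of the attention is used.\<close>

lemma phase_field_has_derivative_locked:
  fixes \<theta> :: "real ^ 'n::finite"
  assumes locked: "\<And>i j. sin (\<theta> $ j - \<theta> $ i) = 0"
  shows "(phase_field \<beta> \<omega> p has_derivative
    (\<lambda>h. \<chi> i. \<Sum>j\<in>UNIV. rope_attention \<beta> \<omega> p \<theta> i j * (cos (\<theta> $ j - \<theta> $ i) * (h $ j - h $ i)))) (at \<theta>)"
proof -
  have comp: "((\<lambda>x. rope_attention \<beta> \<omega> p x i j * sin (x $ j - x $ i)) has_derivative
      (\<lambda>h. rope_attention \<beta> \<omega> p \<theta> i j * (cos (\<theta> $ j - \<theta> $ i) * (h $ j - h $ i)))) (at \<theta>)"
    for i j
  proof -
    have nth: "((\<lambda>x. x $ k) has_derivative (\<lambda>h. h $ k)) (at \<theta>)" for k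
      by (rule bounded_linear_imp_has_derivative[OF bounded_linear_vec_nth])
    have W: "(\<lambda>x. rope_weight \<beta> \<omega> p x i k) differentiable (at \<theta>)" for k
      unfolding rope_weight_def differentiable_def
      by (rule exI, (rule derivative_eq_intros nth refl)+)
    have pos: "(\<Sum>k\<in>UNIV. rope_weight \<beta> \<omega> p \<theta> i k) \<noteq> 0"
      by (intro less_imp_neq[THEN not_sym] sum_pos) (auto simp: rope_weight_def)
    have "(\<lambda>x. rope_attention \<beta> \<omega> p x i j) differentiable (at \<theta>)"
      unfolding rope_attention_def
      using pos W by (intro differentiable_divide differentiable_sum) auto
    then obtain A' where A': "((\<lambda>x. rope_attention \<beta> \<omega> p x i j) has_derivative A') (at \<theta>)"
      by (auto simp: differentiable_def)
    have S: "((\<lambda>x. sin (x $ j - x $ i)) has_derivative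
        (\<lambda>h. cos (\<theta> $ j - \<theta> $ i) * (h $ j - h $ i))) (at \<theta>)"
      by (rule derivative_eq_intros nth refl | simp add: mult.commute)+
    show ?thesis
      using has_derivative_mult[OF A' S] by (simp add: locked)
  qed
  show ?thesis
    unfolding phase_field_def
    by (subst has_derivative_componentwise_within)
       (auto simp: Basis_vec_def inner_axis intro!: has_derivative_sum comp)
qed

text \<open>Modulo \<open>2 \<pi>\<close> the phase difference is an odd multiple of \<open>\<pi>\<close> times the difference of the
  indices.\<close>

lemma twisted_circle_geometry:
  fixes p :: "'n::finite \<Rightarrow> real" and idx :: "'n \<Rightarrow> nat" and m :: int
  assumes \<theta>: "\<theta> \<in> twisted_circle \<omega> p"
    and p: "\<And>j. p j = real (idx j)"
    and \<omega>: "\<omega> = (2 * of_int m + 1) * pi"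
  shows "sin (\<theta> $ j - \<theta> $ i) = 0"
    and "cos (\<theta> $ j - \<theta> $ i) = (-1) ^ idx i * (-1) ^ idx j"
    and "cos (\<theta> $ i - \<theta> $ j + \<omega> * (p i - p j)) = 1"
proof -
  obtain c where c: "\<And>j. [\<theta> $ j = c - \<omega> * p j] (rmod (2 * pi))"
    using \<theta> by (auto simp: twisted_circle_def)
  have "\<exists>k::int. \<theta> $ j = c - \<omega> * p j - of_int k * (2 * pi)" for j
    using c[of j] by (force simp: rcong_altdef)
  then obtain k :: "'n \<Rightarrow> int" where k: "\<And>j. \<theta> $ j = c - \<omega> * p j - of_int (k j) * (2 * pi)"
    by metis
  show "cos (\<theta> $ i - \<theta> $ j + \<omega> * (p i - p j)) = 1"
  proof -
    have "\<theta> $ i - \<theta> $ j + \<omega> * (p i - p j) = of_int (k j - k i) * 2 * pi"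
      by (simp add: k algebra_simps)
    then show ?thesis
      unfolding cos_one_2pi_int by blast
  qed
  \<comment> \<open>The parity of \<open>N\<close> is that of \<open>idx i + idx j\<close>: odd factor \<open>2 m + 1\<close>, even remainder.\<close>
  define N where "N = (2 * m + 1) * (int (idx i) - int (idx j)) + 2 * (k i - k j)"
  have N: "\<theta> $ j - \<theta> $ i = pi * of_int N"
    by (simp add: k N_def p \<omega> algebra_simps)
  show "sin (\<theta> $ j - \<theta> $ i) = 0"
    by (simp add: N sin_int_times_real)
  have "even N \<longleftrightarrow> even (idx i + idx j)"
    by (simp add: N_def)
  then have "cos (pi * of_int N) = (-1) ^ (idx i + idx j)"
    by (simp add: cos_npi_int minus_one_power_iff)
  then show "cos (\<theta> $ j - \<theta> $ i) = (-1) ^ idx i * (-1) ^ idx j"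
    by (simp add: N power_add)
qed

lemma phase_field_twisted_circle:
  fixes p :: "'n::finite \<Rightarrow> real" and idx :: "'n \<Rightarrow> nat" and m :: int
  defines "s \<equiv> (\<chi> i. (-1) ^ idx i) :: real ^ 'n"
  assumes \<theta>: "\<theta> \<in> twisted_circle \<omega> p"
    and p: "\<And>j. p j = real (idx j)"
    and \<omega>: "\<omega> = (2 * of_int m + 1) * pi"
    and sum: "(\<Sum>i\<in>UNIV. s $ i) = 1"
  shows "phase_field \<beta> \<omega> p \<theta> = 0"
    and "(phase_field \<beta> \<omega> p has_derivative sign_operator s) (at \<theta>)"
proof -
  note geo = twisted_circle_geometry[OF \<theta> p \<omega>]
  have att: "rope_attention \<beta> \<omega> p \<theta> i j = 1 / real CARD('n)" for i j
    by (simp add: rope_attention_def rope_weight_def geo(3))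
  show "phase_field \<beta> \<omega> p \<theta> = 0"
    by (simp add: phase_field_def geo(1) Finite_Cartesian_Product.vec_eq_iff)
  have "(\<Sum>j\<in>UNIV. rope_attention \<beta> \<omega> p \<theta> i j * (cos (\<theta> $ j - \<theta> $ i) * (h $ j - h $ i)))
      = sign_operator s h $ i" for h i
  proof -
    have "(\<Sum>j\<in>UNIV. rope_attention \<beta> \<omega> p \<theta> i j * (cos (\<theta> $ j - \<theta> $ i) * (h $ j - h $ i)))
        = (\<Sum>j\<in>UNIV. s $ i / real CARD('n) * (s $ j * h $ j - s $ j * h $ i))"
      by (intro sum.cong refl) (simp add: att geo(2) s_def field_simps)
    also have "\<dots> = s $ i / real CARD('n) * (s \<bullet> h - (\<Sum>j\<in>UNIV. s $ j) * h $ i)"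
      by (simp only: sum_subtractf inner_vec_def inner_real_def
          sum_distrib_left[symmetric] sum_distrib_right[symmetric])
    finally show ?thesis
      by (simp add: sum sign_operator_def)
  qed
  then show "(phase_field \<beta> \<omega> p has_derivative sign_operator s) (at \<theta>)"
    using phase_field_has_derivative_locked[where \<theta> = \<theta> and \<beta> = \<beta> and \<omega> = \<omega> and p = p, OF geo(1)]
    by (simp add: vec_lambda_eta)
qed

lemma jacobian_eq_derivative:
  fixes f :: "real ^ 'n::finite \<Rightarrow> real ^ 'm::finite"
  assumes "(f has_derivative D) (at x)"
  shows "(\<lambda>v. jacobian f (at x) *v v) = D"
proof -
  have "f differentiable (at x)"
    using assms by (rule differentiableI)
  then show ?thesis
    using assms jacobian_works has_derivative_unique by metis
qed

section \<open>The alternating twisted circle as a saddle\<close>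

theorem proposition7p2:
  fixes n r :: nat and \<beta> \<omega> :: real
    and idx :: "'n::finite \<Rightarrow> nat" and p :: "'n \<Rightarrow> real"
  assumes "r \<ge> 1" and "n = 2 * r + 1"
    and "bij_betw idx UNIV {0..<n}"
    and "\<And>j. p j = real (idx j)"
    and "\<beta> \<ge> 0"
    and "\<exists>m::int. \<omega> = (2 * of_int m + 1) * pi"
  shows
    "to_torus ` twisted_circle \<omega> p homeomorphic sphere (0::complex) 1 \<and>
     (\<forall>\<theta> \<in> twisted_circle \<omega> p.
       phase_field \<beta> \<omega> p \<theta> = 0 \<and>
       phase_field \<beta> \<omega> p differentiable at \<theta> \<and>
       (let J = jacobian (phase_field \<beta> \<omega> p) (at \<theta>) in
          endo_spec (\<lambda>v. J *v v) =
            replicate_mset r (- 1 / of_nat n) + replicate_mset 1 0 +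
            replicate_mset (r - 1) (1 / of_nat n) + replicate_mset 1 1 \<and>
          {v. J *v v = 0} = span {1} \<and>
          (\<exists>!K. linear K \<and> (\<forall>v. K (quot_proj v) = quot_proj (J *v v))) \<and>
          (\<forall>K. linear K \<and> (\<forall>v. K (quot_proj v) = quot_proj (J *v v)) \<longrightarrow>
             hyperbolic_saddle K \<and> stable_dim K = r \<and> unstable_dim K = r)))"
proof -
  define s :: "real ^ 'n" where "s = (\<chi> i. (-1) ^ idx i)"
  have card: "CARD('n) = 2 * r + 1"
    using bij_betw_same_card[OF assms(3)] assms(2) by simp
  have "(\<Sum>i\<in>UNIV. s $ i) = (\<Sum>k\<in>{0..<n}. (-1) ^ k)"
    unfolding s_def using sum.reindex_bij_betw[OF assms(3), of "\<lambda>k. (-1 :: real) ^ k"] by simp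
  also have "\<dots> = 1"
    unfolding assms(2) by (induction r) auto
  finally have sum: "(\<Sum>i\<in>UNIV. s $ i) = 1" .
  interpret balanced_signs s
    by standard (simp_all add: sum, simp add: s_def minus_one_power_iff)
  obtain m :: int where \<omega>: "\<omega> = (2 * of_int m + 1) * pi"
    using assms(6) by blast
  let ?ds = "replicate r (- 1 / real CARD('n)) @ replicate (r - 1) (1 / real CARD('n)) @ [1]"
  obtain es where basis: "is_basis (1 # es)"
    and eig: "list_all2 (\<lambda>b d. sign_operator s b = d *\<^sub>R b) es ?ds"
    using sign_eigenbasis[OF card assms(1)] by blast
  have "list_all2 (\<lambda>b d. sign_operator s b = d *\<^sub>R b) (1 # es) (0 # ?ds)"
    using eig by (simp add: sign_operator_one)
  from endo_spec_eigenbasis[OF basis linear_sign_operator this]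
  have spec: "endo_spec (sign_operator s) =
      replicate_mset r (- 1 / of_nat n) + replicate_mset 1 0 +
      replicate_mset (r - 1) (1 / of_nat n) + replicate_mset 1 1"
    by (simp add: card assms(2))
  have quot: "hyperbolic_saddle K \<and> stable_dim K = r \<and> unstable_dim K = r"
    if K: "linear K" "\<forall>v. K (quot_proj v) = quot_proj (sign_operator s v)" for K
  proof -
    note specK = endo_spec_induced_quotient_map[OF basis eig K]
    have stable: "stable_dim K = r" and unstable: "unstable_dim K = r"
      using assms(1) by (simp_all add: stable_unstable_dim_real_spec[OF specK])
    have "hyperbolic K"
      unfolding hyperbolic_def specK by auto
    then show ?thesis
      using stable unstable assms(1) by (simp add: hyperbolic_saddle_def)
  qed
  show ?thesis
  proof (intro conjI ballI)
    show "to_torus ` twisted_circle \<omega> p homeomorphic sphere (0::complex) 1"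
      by (rule homeomorphic_to_torus_twisted_circle)
  next
    fix \<theta> assume \<theta>: "\<theta> \<in> twisted_circle \<omega> p"
    note flow = phase_field_twisted_circle[OF \<theta> assms(4) \<omega> sum[unfolded s_def], folded s_def]
    show "phase_field \<beta> \<omega> p \<theta> = 0"
      by (rule flow)
    show "phase_field \<beta> \<omega> p differentiable at \<theta>"
      by (rule differentiableI[OF flow(2)])
    have J: "jacobian (phase_field \<beta> \<omega> p) (at \<theta>) *v v = sign_operator s v" for v
      using jacobian_eq_derivative[OF flow(2)] by metis
    show "let J = jacobian (phase_field \<beta> \<omega> p) (at \<theta>) in
          endo_spec (\<lambda>v. J *v v) =
            replicate_mset r (- 1 / of_nat n) + replicate_mset 1 0 +
            replicate_mset (r - 1) (1 / of_nat n) + replicate_mset 1 1 \<and>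
          {v. J *v v = 0} = span {1} \<and>
          (\<exists>!K. linear K \<and> (\<forall>v. K (quot_proj v) = quot_proj (J *v v))) \<and>
          (\<forall>K. linear K \<and> (\<forall>v. K (quot_proj v) = quot_proj (J *v v)) \<longrightarrow>
             hyperbolic_saddle K \<and> stable_dim K = r \<and> unstable_dim K = r)"
      unfolding Let_def J
      using spec kernel_sign_operator quot
        ex1_induced_quotient_map[OF linear_sign_operator sign_operator_one]
      by blast
  qed
qed

end
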